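(* Let $X$ be a finite metric space with $n$ points such that $d(x,x') > \ln(n-1)$ for every pair of distinct points $x,x'\in X$ (for $n\in\{0,1\}$ this condition is vacuously satisfied). Then $X$ has a well-defined magnitude, i.e. there exists a weighting on $X$.
   Context: A weighting on a finite metric space $(X,d)$ is a choice of real number $w_x$ for each $x\in X$ such that $\sum_{x'\in X} e^{-d(x,x')}w_{x'}=1$ for every $x\in X$. If a weighting exists, the magnitude of $X$ is said to be well-defined and is $|X| := \sum_{x\in X} w_x$; this is independent of the choice of weighting. *)

theory Defs
  imports "HOL-Analysis.Analysis"
begin

text \<open>A weighting is a family indexed by \<open>X\<close>; the values of \<open>w\<close> outside \<open>X\<close> are irrelevant.\<close>

definition is_weighting :: "'a set \<Rightarrow> ('a \<Rightarrow> 'a \<Rightarrow> real) \<Rightarrow> ('a \<Rightarrow> real) \<Rightarrow> bool" where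
  "is_weighting X d w \<longleftrightarrow> (\<forall>x\<in>X. (\<Sum>x'\<in>X. exp (- d x x') * w x') = 1)"

definition magnitude_well_defined :: "'a set \<Rightarrow> ('a \<Rightarrow> 'a \<Rightarrow> real) \<Rightarrow> bool" where
  "magnitude_well_defined X d \<longleftrightarrow> (\<exists>w. is_weighting X d w)"

end

(* The matrix exp(-d(x,x')) has ones on its diagonal and off-diagonal entries below 1/(n-1), so it is
   strictly diagonally dominant. Such a matrix is surjective: Gaussian elimination never meets a zero
   pivot, because eliminating one variable leaves a system that is again strictly diagonally dominant. *)
theory Submission
  imports Defs
begin

lemma strictly_diagonally_dominant_solvable:
  fixes A :: "'a \<Rightarrow> 'a \<Rightarrow> real" and b :: "'a \<Rightarrow> real"
  assumes "finite S"
    and "\<And>x. x \<in> S \<Longrightarrow> (\<Sum>y\<in>S - {x}. \<bar>A x y\<bar>) < \<bar>A x x\<bar>"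
  shows "\<exists>w. \<forall>x\<in>S. (\<Sum>y\<in>S. A x y * w y) = b x"
  using assms
\<comment> \<open>Both \<open>A\<close> and \<open>b\<close> must vary, since elimination changes
  the coefficients and the right-hand side.\<close>
proof (induction S arbitrary: A b rule: finite_induct)
  case empty
  then show ?case by simp
next
  case (insert a F)
  have row_a: "(\<Sum>y\<in>F. \<bar>A a y\<bar>) < \<bar>A a a\<bar>"
    using insert.prems[of a] insert.hyps by simp
  then have pivot: "A a a \<noteq> 0"
    using sum_abs_ge_zero[of "A a" F] by linarith
  \<comment> \<open>Subtracting \<open>q x\<close> times row \<open>a\<close> from row
    \<open>x\<close> clears column \<open>a\<close>; on \<open>F\<close> the remaining matrix
    \<open>B\<close> is the Schur complement of the pivot.\<close>
  define q where "q x = A x a / A a a" for x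
  define B where "B x y = A x y - q x * A a y" for x y
  have "(\<Sum>y\<in>F - {x}. \<bar>B x y\<bar>) < \<bar>B x x\<bar>" if x: "x \<in> F" for x
  proof -
    have "(\<Sum>y\<in>F - {x}. \<bar>B x y\<bar>) \<le> (\<Sum>y\<in>F - {x}. \<bar>A x y\<bar> + \<bar>q x\<bar> * \<bar>A a y\<bar>)"
      unfolding B_def by (intro sum_mono) (metis abs_mult abs_triangle_ineq4)
    \<comment> \<open>The sum over row \<open>a\<close> is completed to all of \<open>F\<close>; the
      term subtracted in return will absorb the possible loss on the diagonal, where
      \<open>B x x = A x x - q x * A a x\<close>.\<close>
    also have "\<dots> = (\<Sum>y\<in>F - {x}. \<bar>A x y\<bar>) + \<bar>q x\<bar> * (\<Sum>y\<in>F. \<bar>A a y\<bar>) - \<bar>q x\<bar> * \<bar>A a x\<bar>"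
      using insert.hyps x
      by (simp add: sum.distrib sum_distrib_left[symmetric] sum_diff1 right_diff_distrib)
    \<comment> \<open>Dominance of row \<open>a\<close> bounds the mass added to row
      \<open>x\<close> by \<bar>\<open>A x a\<close>\<bar>, the entry that elimination removes.
      Equality is possible here, as \<open>q x\<close> may vanish; strictness comes from row
      \<open>x\<close> itself.\<close>
    also have "\<bar>q x\<bar> * (\<Sum>y\<in>F. \<bar>A a y\<bar>) \<le> \<bar>q x\<bar> * \<bar>A a a\<bar>"
      using row_a by (intro mult_left_mono) auto
    also have "\<bar>q x\<bar> * \<bar>A a a\<bar> = \<bar>A x a\<bar>"
      using pivot by (simp add: q_def abs_divide)
    also have "(\<Sum>y\<in>F - {x}. \<bar>A x y\<bar>) + \<bar>A x a\<bar> = (\<Sum>y\<in>insert a F - {x}. \<bar>A x y\<bar>)"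
    proof -
      have "insert a F - {x} = insert a (F - {x})" using x insert.hyps by auto
      then show ?thesis using insert.hyps by simp
    qed
    also have "\<dots> < \<bar>A x x\<bar>"
      using insert.prems x by blast
    finally have "(\<Sum>y\<in>F - {x}. \<bar>B x y\<bar>) < \<bar>A x x\<bar> - \<bar>q x * A a x\<bar>"
      by (simp add: abs_mult)
    also have "\<dots> \<le> \<bar>B x x\<bar>"
      unfolding B_def by (rule abs_triangle_ineq2)
    finally show ?thesis .
  qed
  from insert.IH[OF this, of "\<lambda>x. b x - q x * b a"]
  obtain w where w: "\<And>x. x \<in> F \<Longrightarrow> (\<Sum>y\<in>F. B x y * w y) = b x - q x * b a"
    by auto
  define r where "r = (\<Sum>y\<in>F. A a y * w y)"
  \<comment> \<open>Back substitution: the value at \<open>a\<close> is the one that solves row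
    \<open>a\<close>.\<close>
  define v where "v = w(a := (b a - r) / A a a)"
  have row: "(\<Sum>y\<in>insert a F. A x y * v y) = A x a * ((b a - r) / A a a) + (\<Sum>y\<in>F. A x y * w y)" for x
  proof -
    have "(\<Sum>y\<in>F. A x y * v y) = (\<Sum>y\<in>F. A x y * w y)"
      using insert.hyps by (intro sum.cong) (auto simp: v_def)
    then show ?thesis using insert.hyps by (simp add: v_def)
  qed
  have "(\<Sum>y\<in>insert a F. A x y * v y) = b x" if "x \<in> insert a F" for x
  proof (cases "x = a")
    case True
    then show ?thesis using pivot by (simp only: row) (simp add: r_def)
  next
    case False
    \<comment> \<open>Undoing the row operation leaves the defect \<open>q x * (b a - r)\<close> in
      row \<open>x\<close>, which is exactly \<open>A x a * v a\<close>.\<close>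
    have "(\<Sum>y\<in>F. B x y * w y) = (\<Sum>y\<in>F. A x y * w y) - q x * r"
      by (simp add: B_def r_def left_diff_distrib sum_subtractf sum_distrib_left mult.assoc)
    then have "(\<Sum>y\<in>F. A x y * w y) = b x - q x * (b a - r)"
      using w[of x] that False by (simp add: algebra_simps)
    then show ?thesis by (simp only: row) (simp add: q_def)
  qed
  then show ?case by blast
qed

theorem theorem2:
  fixes X :: "'a set" and d :: "'a \<Rightarrow> 'a \<Rightarrow> real" and n :: nat
  assumes "Metric_space X d"
    and "finite X"
    and "card X = n"
    and "\<And>x x'. \<lbrakk>x \<in> X; x' \<in> X; x \<noteq> x'\<rbrakk> \<Longrightarrow> d x x' > ln (real n - 1)"
  shows "magnitude_well_defined X d"
proof -
  have "(\<Sum>y\<in>X - {x}. \<bar>exp (- d x y)\<bar>) < \<bar>exp (- d x x)\<bar>" if x: "x \<in> X" for x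
  proof -
    have diag: "d x x = 0"
      using Metric_space.mdist_zero[OF assms(1) x] .
    show ?thesis
    \<comment> \<open>A one-point space is split off because 1/(n-1) is meaningful only for n \<ge>
      2, and a strict comparison of sums needs a nonempty index set.\<close>
    proof (cases "X - {x} = {}")
      case True
      show ?thesis unfolding True by simp
    next
      case False
      have card: "card (X - {x}) = n - 1"
        using assms(2,3) x by simp
      moreover have "0 < card (X - {x})"
        using False assms(2) by (simp add: card_gt_0_iff)
      ultimately have n: "n \<ge> 2" by simp
      have "exp (- d x y) < 1 / (real n - 1)" if "y \<in> X - {x}" for y
      proof -
        have "- d x y < - ln (real n - 1)" using assms(4)[of x y] x that by auto
        then have "exp (- d x y) < exp (- ln (real n - 1))" by simp
        also have "\<dots> = 1 / (real n - 1)" using n by (simp add: exp_minus inverse_eq_divide)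
        finally show ?thesis .
      qed
      then have "(\<Sum>y\<in>X - {x}. exp (- d x y)) < (\<Sum>y\<in>X - {x}. 1 / (real n - 1))"
        using False assms(2) by (intro sum_strict_mono) auto
      also have "\<dots> = 1" using n card by (simp add: of_nat_diff)
      finally show ?thesis by (simp add: diag)
    qed
  qed
  from strictly_diagonally_dominant_solvable[OF assms(2) this]
  show ?thesis
    unfolding magnitude_well_defined_def is_weighting_def .
qed

end
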